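(* Let $\alpha\in[0,1]$ and $n\ge3$, let $d_1,\dots,d_r$ be the distinct divisors $d$ of $n$ with $1<d<n$, and let $\mathbb G_n$ be the graph on $\{d_1,\dots,d_r\}$ in which $d_i\sim d_j$ ($i\ne j$) iff $d_i\mid d_j$ or $d_j\mid d_i$. For $i=1,\dots,r$ put $\beta_i=\phi(n)+1+\sum_{j:\,d_j\sim d_i}\phi(d_j)$. Then the $A_\alpha$-spectrum of the power graph $\mathcal P(\mathbb Z_n)$ consists of $\alpha n-1$ with multiplicity $\phi(n)$, the eigenvalue $\alpha(\phi(d_i)+\beta_i)-1$ with multiplicity $\phi(d_i)-1$ for each $i=1,\dots,r$, and the $r+1$ eigenvalues of the $(r+1)\times(r+1)$ matrix $M=(M_{ij})_{0\le i,j\le r}$ with $M_{00}=\phi(n)+\alpha(n-1-\phi(n))$, $M_{0j}=(1-\alpha)\phi(d_j)$ and $M_{j0}=(1-\alpha)(\phi(n)+1)$ for $j\ge1$, $M_{ii}=\alpha\beta_i+\phi(d_i)-1$ for $i\ge1$, and for $i\ne j$, $i,j\ge1$, $M_{ij}=(1-\alpha)\phi(d_j)$ if $d_i\sim d_j$ in $\mathbb G_n$ and $M_{ij}=0$ otherwise.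
   Context: $\phi$ is Euler's totient function. For a simple graph $G$ with adjacency matrix $A(G)$ and diagonal degree matrix $D(G)$, and $\alpha\in[0,1]$, $A_\alpha(G)=\alpha D(G)+(1-\alpha)A(G)$; its $A_\alpha$-spectrum is the multiset of its eigenvalues. The power graph $\mathcal P(\mathcal G)$ of a finite group $\mathcal G$ has vertex set $\mathcal G$, two distinct elements $x,y$ being adjacent iff one is a positive power of the other. $\mathbb Z_n$ is the cyclic group of order $n$. *)

theory Defs
  imports
    "HOL-Number_Theory.Totient"
    "HOL-Algebra.Elementary_Groups"
    "HOL-Computational_Algebra.Fundamental_Theorem_Algebra"
    "Jordan_Normal_Form.Spectral_Radius"
    "Graph_Theory.Pair_Digraph"
begin

text \<open>
  A finite simple graph is a \<^locale>\<open>pair_graph\<close>: a finite, loop-free, symmetric relation on a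
  vertex set; each edge is present as two opposite arcs.  Matrices of a graph \<open>G\<close> refer to an
  enumeration \<open>v\<close> of its vertices by \<open>{..<card (pverts G)}\<close>.
\<close>

definition adjacency_mat :: "'a pair_pre_digraph \<Rightarrow> (nat \<Rightarrow> 'a) \<Rightarrow> real mat" where
  "adjacency_mat G v = mat (card (pverts G)) (card (pverts G))
     (\<lambda>(i, j). if (v i, v j) \<in> parcs G then 1 else 0)"

definition degree_mat :: "'a pair_pre_digraph \<Rightarrow> (nat \<Rightarrow> 'a) \<Rightarrow> real mat" where
  "degree_mat G v = mat (card (pverts G)) (card (pverts G))
     (\<lambda>(i, j). if i = j then real (out_degree (with_proj G) (v i)) else 0)"

definition A_alpha_mat :: "real \<Rightarrow> 'a pair_pre_digraph \<Rightarrow> (nat \<Rightarrow> 'a) \<Rightarrow> real mat" where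
  "A_alpha_mat \<alpha> G v = \<alpha> \<cdot>\<^sub>m degree_mat G v + (1 - \<alpha>) \<cdot>\<^sub>m adjacency_mat G v"

text \<open>
  The multiset of all eigenvalues in the complex numbers, with algebraic multiplicities, so that an
  \<open>n \<times> n\<close> matrix always has exactly \<open>n\<close> of them.
\<close>

definition eigenvalues_mset :: "real mat \<Rightarrow> complex multiset" where
  "eigenvalues_mset A = proots (char_poly (map_mat complex_of_real A))"

lemma set_eigenvalues_mset:
  assumes "A \<in> carrier_mat n n"
  shows "set_mset (eigenvalues_mset A) = spectrum (map_mat complex_of_real A)"
proof -
  have A: "map_mat complex_of_real A \<in> carrier_mat n n" using assms by simp
  have "char_poly (map_mat complex_of_real A) \<noteq> 0"
    using degree_monic_char_poly[OF A] by auto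
  then show ?thesis
    by (auto simp: eigenvalues_mset_def spectrum_def eigenvalue_root_char_poly[OF A])
qed

lemma size_eigenvalues_mset:
  assumes "A \<in> carrier_mat n n"
  shows "size (eigenvalues_mset A) = n"
proof -
  have A: "map_mat complex_of_real A \<in> carrier_mat n n" using assms by simp
  show ?thesis
    using degree_monic_char_poly[OF A] by (simp add: eigenvalues_mset_def size_proots_complex)
qed

definition power_graph :: "('a, 'b) monoid_scheme \<Rightarrow> 'a pair_pre_digraph" where
  "power_graph \<G> = \<lparr> pverts = carrier \<G>,
     parcs = {(x, y). x \<in> carrier \<G> \<and> y \<in> carrier \<G> \<and> x \<noteq> y \<and>
       (\<exists>k::nat. k > 0 \<and> (y = x [^]\<^bsub>\<G>\<^esub> k \<or> x = y [^]\<^bsub>\<G>\<^esub> k))} \<rparr>"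

lemma pair_graph_power_graph:
  assumes "finite (carrier \<G>)"
  shows "pair_graph (power_graph \<G>)"
proof
  show "finite (parcs (power_graph \<G>))"
    by (rule finite_subset[of _ "carrier \<G> \<times> carrier \<G>"])
      (auto simp: power_graph_def assms)
  show "symmetric (with_proj (power_graph \<G>))"
    by (auto simp: symmetric_def sym_def power_graph_def)
qed (auto simp: power_graph_def assms)

definition nontrivial_divisors :: "nat \<Rightarrow> nat set" where
  "nontrivial_divisors n = {d. d dvd n \<and> 1 < d \<and> d < n}"

definition divisor_graph :: "nat \<Rightarrow> nat pair_pre_digraph" where
  "divisor_graph n = \<lparr> pverts = nontrivial_divisors n,
     parcs = {(a, b). a \<in> nontrivial_divisors n \<and> b \<in> nontrivial_divisors n \<and> a \<noteq> b \<and>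
       (a dvd b \<or> b dvd a)} \<rparr>"

lemma pair_graph_divisor_graph: "pair_graph (divisor_graph n)"
proof
  have fin: "finite (nontrivial_divisors n)"
    by (rule finite_subset[of _ "{..<n}"]) (auto simp: nontrivial_divisors_def)
  then show "finite (pverts (divisor_graph n))"
    by (simp add: divisor_graph_def)
  show "finite (parcs (divisor_graph n))"
    by (rule finite_subset[of _ "nontrivial_divisors n \<times> nontrivial_divisors n"])
      (auto simp: divisor_graph_def fin)
  show "symmetric (with_proj (divisor_graph n))"
    by (auto simp: symmetric_def sym_def divisor_graph_def)
qed (auto simp: divisor_graph_def)

text \<open>The sequence \<open>d 1, \<dots>, d r\<close> lists the vertices of the divisor graph.\<close>

definition beta :: "nat \<Rightarrow> nat \<Rightarrow> (nat \<Rightarrow> nat) \<Rightarrow> nat \<Rightarrow> nat" where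
  "beta n r d i = totient n + 1 +
     (\<Sum>j | j \<in> {1..r} \<and> (d j, d i) \<in> parcs (divisor_graph n). totient (d j))"

definition quotient_mat :: "real \<Rightarrow> nat \<Rightarrow> nat \<Rightarrow> (nat \<Rightarrow> nat) \<Rightarrow> real mat" where
  "quotient_mat \<alpha> n r d = mat (r + 1) (r + 1) (\<lambda>(i, j).
     if i = 0 \<and> j = 0 then real (totient n) + \<alpha> * (real n - 1 - real (totient n))
     else if i = 0 then (1 - \<alpha>) * real (totient (d j))
     else if j = 0 then (1 - \<alpha>) * (real (totient n) + 1)
     else if i = j then \<alpha> * real (beta n r d i) + real (totient (d i)) - 1
     else if (d i, d j) \<in> parcs (divisor_graph n) then (1 - \<alpha>) * real (totient (d j))
     else 0)"

end

theory Submission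
  imports Defs
begin

text \<open>
  In \<open>\<int>\<^sub>n\<close> one of \<open>x, y\<close> is a positive multiple of the other iff one of their orders divides
  the other.  So the entries of \<open>A\<^sub>\<alpha>\<close> depend only on the orders of the row and column elements,
  apart from the diagonal, and the orders \<open>1\<close> and \<open>n\<close>, being comparable to every order, can be
  merged into one class.  With \<open>S\<close> the indicator matrix of the classes this says
  \<open>A\<^sub>\<alpha> = D + S B S\<^sup>T\<close>, where \<open>D\<close> is diagonal and constant on classes, \<open>D S = S \<Lambda>\<close>.
  The block matrix with rows \<open>(X - D, S)\<close> and \<open>(B S\<^sup>T, 1)\<close> can be made block triangular in two
  ways, so \<open>det (X - \<Lambda>) \<cdot> det (X - A\<^sub>\<alpha>) = det (X - D) \<cdot> det (X - \<Lambda> - B S\<^sup>T S)\<close>, and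
  \<open>\<Lambda> + B S\<^sup>T S\<close> is the quotient matrix since \<open>S\<^sup>T S\<close> is the diagonal matrix of class sizes.
\<close>

section \<open>Determinants and characteristic polynomials of block-constant matrices\<close>

lemma det_intertwine:
  fixes P :: "'a :: idom mat"
  assumes P: "P \<in> carrier_mat n n" and R: "R \<in> carrier_mat m m"
    and S: "S \<in> carrier_mat n m" and C: "C \<in> carrier_mat m n"
    and PS: "P * S = S * R"
  shows "det R * det (P - S * C) = det P * det (R - C * S)"
proof -
  define M where "M = four_block_mat P S C (1\<^sub>m m)"
  have M: "M \<in> carrier_mat (n + m) (n + m)"
    unfolding M_def using P by (intro four_block_carrier_mat) auto
  \<comment> \<open>The upper right block after the second multiplication below; the intertwining
    relation is exactly what makes it vanish.\<close>
  have mP: "P * - S + S * R = 0\<^sub>m n m"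
    using P S R PS by (simp add: uminus_l_inv_mat[of "S * R" n m])
  have SC: "P * 1\<^sub>m n + S * - C = P - S * C"
    using P S C by (simp add: minus_add_uminus_mat[of P n n])
  have CS: "C * - S + 1\<^sub>m m * R = R - C * S"
    using R S C
    by (simp add: minus_add_uminus_mat[of R m m] comm_add_mat[of _ m m])
  have "M * four_block_mat (1\<^sub>m n) (0\<^sub>m n m) (- C) (1\<^sub>m m) =
      four_block_mat (P - S * C) S (0\<^sub>m m n) (1\<^sub>m m)"
    unfolding M_def using P S C
    by (subst mult_four_block_mat[of _ n n _ m _ m _ _ n _ m])
      (auto simp: SC[simplified] intro!: cong_four_block_mat)
  then have "det (M * four_block_mat (1\<^sub>m n) (0\<^sub>m n m) (- C) (1\<^sub>m m)) = det (P - S * C)"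
    using P S C by (simp add: det_four_block_mat_lower_left_zero[of _ n _ m] minus_carrier_mat)
  moreover have "det (M * four_block_mat (1\<^sub>m n) (0\<^sub>m n m) (- C) (1\<^sub>m m)) = det M"
    using C by (subst det_mult[OF M])
      (auto simp: det_four_block_mat_upper_right_zero[of _ n _ m])
  \<comment> \<open>This clears \<open>S\<close> without inverting \<open>P\<close>, so polynomial
    entries are allowed; the price is the factor \<open>det R\<close>.\<close>
  moreover have "M * four_block_mat (1\<^sub>m n) (- S) (0\<^sub>m m n) R =
      four_block_mat P (0\<^sub>m n m) C (R - C * S)"
    unfolding M_def using P S C R mP CS
    by (subst mult_four_block_mat[of _ n n _ m _ m _ _ n _ m])
      (auto intro!: cong_four_block_mat)
  then have "det (M * four_block_mat (1\<^sub>m n) (- S) (0\<^sub>m m n) R) = det P * det (R - C * S)"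
    using P S C R by (simp add: det_four_block_mat_upper_right_zero[of _ n _ m] minus_carrier_mat)
  moreover have "det (M * four_block_mat (1\<^sub>m n) (- S) (0\<^sub>m m n) R) = det M * det R"
    using S R by (subst det_mult[OF M])
      (auto simp: det_four_block_mat_lower_left_zero[of _ n _ m])
  ultimately show ?thesis by (simp add: mult.commute)
qed

lemma det_mat_diag: "det (mat_diag n f) = (\<Prod>i<n. f i)"
proof -
  have "det (mat_diag n f) = prod_list (diag_mat (mat_diag n f))"
    by (rule det_upper_triangular[of _ n]) (auto simp: mat_diag_def)
  also have "\<dots> = (\<Prod>i<n. f i)"
    by (simp add: prod_list_diag_prod atLeast0LessThan mat_diag_def)
  finally show ?thesis .
qed

text \<open>Taking \<open>b k k\<close> off the diagonal entry \<open>a k\<close> leaves a matrix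
  that depends only on the pair of classes, so \<open>det_intertwine\<close> reduces it to size
  \<open>m\<close>. Vectors supported on one class with entries summing to zero are eigenvectors for
  \<open>a k - b k k\<close>, whence the exponent \<open>s k - 1\<close>.\<close>

lemma char_poly_blockwise_constant:
  fixes a :: "nat \<Rightarrow> 'a :: idom" and b :: "nat \<Rightarrow> nat \<Rightarrow> 'a" and c s :: "nat \<Rightarrow> nat"
  assumes c: "\<And>i. i < N \<Longrightarrow> c i < m"
    and s: "\<And>k. k < m \<Longrightarrow> card {i. i < N \<and> c i = k} = s k"
    and s_pos: "\<And>k. k < m \<Longrightarrow> s k > 0"
  shows "char_poly (mat N N (\<lambda>(i, j). if i = j then a (c i) else b (c i) (c j))) =
    (\<Prod>k<m. [:b k k - a k, 1:] ^ (s k - 1)) *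
    char_poly (mat m m (\<lambda>(k, l). if k = l then a k + of_nat (s k - 1) * b k k
      else of_nat (s l) * b k l))"
    (is "char_poly ?A = _ * char_poly ?Q")
proof -
  define L where "L = (\<lambda>k. [:b k k - a k, 1:])"
  define P where "P = mat_diag N (\<lambda>i. L (c i))"
  define R where "R = mat_diag m L"
  define S :: "'a poly mat" where "S = mat N m (\<lambda>(i, k). if c i = k then 1 else 0)"
  define C where "C = mat m N (\<lambda>(k, j). [:b k (c j):])"
  have carrier: "P \<in> carrier_mat N N" "R \<in> carrier_mat m m" "S \<in> carrier_mat N m"
    "C \<in> carrier_mat m N"
    by (auto simp: P_def R_def S_def C_def)
  have "P * S = S * R"
    unfolding P_def R_def mat_diag_mult_left[OF carrier(3)] mat_diag_mult_right[OF carrier(3)]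
    by (rule eq_matI) (auto simp: S_def)
  note det_eq = det_intertwine[OF carrier this]
  have SC: "(S * C) $$ (i, j) = [:b (c i) (c j):]" if "i < N" "j < N" for i j
  proof -
    have "(S * C) $$ (i, j) = (\<Sum>k = 0..<m. (if c i = k then 1 else 0) * [:b k (c j):])"
      using that by (simp add: S_def C_def scalar_prod_def)
    also have "\<dots> = (\<Sum>k = 0..<m. if c i = k then [:b k (c j):] else 0)"
      by (intro sum.cong) auto
    also have "\<dots> = [:b (c i) (c j):]"
      using c[OF that(1)] by simp
    finally show ?thesis .
  qed
  have CS: "(C * S) $$ (k, l) = [:of_nat (s l) * b k l:]" if "k < m" "l < m" for k l
  proof -
    have "(C * S) $$ (k, l) = (\<Sum>i = 0..<N. [:b k (c i):] * (if c i = l then 1 else 0))"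
      using that by (simp add: S_def C_def scalar_prod_def)
    also have "\<dots> = (\<Sum>i = 0..<N. if c i = l then [:b k l:] else 0)"
      by (intro sum.cong) auto
    also have "\<dots> = (\<Sum>i | i < N \<and> c i = l. [:b k l:])"
      by (subst sum.inter_filter[symmetric]) (auto intro!: sum.cong)
    also have "\<dots> = [:of_nat (s l) * b k l:]"
      using s[OF that(2)] by (simp add: of_nat_poly)
    finally show ?thesis .
  qed
  have A: "char_poly_matrix ?A = P - S * C"
    using carrier
    by (intro eq_matI) (auto simp: char_poly_matrix_def SC P_def L_def mat_diag_def
        simp del: index_mult_mat(1))
  \<comment> \<open>One of the \<open>s k\<close> copies of \<open>b k k\<close> on the diagonal of
    \<open>C * S\<close> is absorbed by \<open>L k\<close>, which leaves
    \<open>s k - 1\<close>.\<close>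
  have Q: "char_poly_matrix ?Q = R - C * S"
    using carrier s_pos
    by (intro eq_matI) (auto simp: char_poly_matrix_def CS R_def L_def mat_diag_def
        of_nat_diff Suc_le_eq algebra_simps simp del: index_mult_mat(1))
  have "(\<Prod>k<m. L k) * char_poly ?A = (\<Prod>i<N. L (c i)) * char_poly ?Q"
    using det_eq by (simp add: char_poly_def A Q P_def R_def det_mat_diag)
  also have "(\<Prod>i<N. L (c i)) = (\<Prod>k<m. \<Prod>i\<in>{i\<in>{..<N}. c i = k}. L (c i))"
    using c by (intro prod.group[symmetric]) auto
  also have "\<dots> = (\<Prod>k<m. L k ^ s k)"
    using s by (intro prod.cong) auto
  \<comment> \<open>Each class is nonempty, so one factor \<open>L k\<close> can be split off and
    cancelled against the left side, the \<open>L k\<close> being monic.\<close>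
  also have "\<dots> = (\<Prod>k<m. L k * L k ^ (s k - 1))"
    by (intro prod.cong) (auto simp: power_eq_if dest!: s_pos)
  finally have "(\<Prod>k<m. L k) * char_poly ?A =
      (\<Prod>k<m. L k) * ((\<Prod>k<m. L k ^ (s k - 1)) * char_poly ?Q)"
    by (simp add: prod.distrib mult.assoc)
  moreover have "(\<Prod>k<m. L k) \<noteq> 0"
    by (simp add: L_def)
  ultimately show ?thesis
    by (simp add: L_def)
qed

section \<open>Orders of residues and arcs of the power graph\<close>

text \<open>For \<open>n > 0\<close> this is the order of \<open>x\<close> in the additive group
  Z_n; the residue 0 has gcd \<open>n\<close>, hence order 1.\<close>

definition residue_order :: "nat \<Rightarrow> int \<Rightarrow> nat" where
  "residue_order n x = n div nat (gcd x (int n))"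

text \<open>Bezout: modulo \<open>n\<close>, the multiples of \<open>x\<close> are the multiples of
  its gcd with \<open>n\<close>. Powers in the additive group are such multiples.\<close>

lemma multiple_mod_iff_gcd_dvd:
  fixes x y :: int
  assumes "n > 0" "y \<in> {0..<int n}"
  shows "(\<exists>k::nat. k > 0 \<and> y = (int k * x) mod int n) \<longleftrightarrow> gcd x (int n) dvd gcd y (int n)"
proof
  assume "\<exists>k::nat. k > 0 \<and> y = (int k * x) mod int n"
  then show "gcd x (int n) dvd gcd y (int n)"
    by (auto simp: dvd_mod_iff)
next
  assume "gcd x (int n) dvd gcd y (int n)"
  then have "gcd x (int n) dvd y" by simp
  then obtain z where z: "[x * z = y] (mod int n)"
    using cong_solve_dvd_int[of x "int n" y] by metis
  \<comment> \<open>Adding \<open>n\<close> keeps the residue and makes the multiplier positive even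
    if \<open>z mod n\<close> is 0.\<close>
  define k where "k = nat (z mod int n + int n)"
  have "z mod int n \<ge> 0" using assms by simp
  then have k: "int k = z mod int n + int n" "k > 0"
    using assms by (auto simp: k_def intro: add_nonneg_pos)
  have "(int k * x) mod int n = (x * z) mod int n"
    unfolding k(1) by (simp add: mod_mult_right_eq distrib_left mult.commute[of _ x])
  also have "\<dots> = y" using z assms by (simp add: cong_def)
  finally show "\<exists>k::nat. k > 0 \<and> y = (int k * x) mod int n" using k by metis
qed

lemma residue_order_dvd: "residue_order n x dvd n"
  unfolding residue_order_def
  by (metis dvd_div_mult_self dvd_triv_left gcd_dvd2 gcd_ge_0_int int_dvd_int_iff int_nat_eq)

text \<open>Order and gcd are complementary factors of \<open>n\<close>, so passing from one to the
  other reverses divisibility.\<close>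

lemma residue_order_dvd_iff:
  assumes "n > 0"
  shows "residue_order n y dvd residue_order n x \<longleftrightarrow> gcd x (int n) dvd gcd y (int n)"
proof -
  define g where "g = (\<lambda>x. nat (gcd x (int n)))"
  have g: "int (g x) = gcd x (int n)" for x by (simp add: g_def)
  have "g x dvd n" "g y dvd n"
    using gcd_dvd2[of _ "int n"] by (simp_all flip: int_dvd_int_iff add: g)
  then obtain a b where ab: "n = g x * a" "n = g y * b" by (metis dvd_def)
  then have pos: "g x > 0" "g y > 0" "a > 0" "b > 0" using assms by (auto intro: Nat.gr0I)
  have o: "residue_order n x = a" "residue_order n y = b"
    using div_mult_self1_is_m[OF pos(1), of a] div_mult_self1_is_m[OF pos(2), of b]
    unfolding ab[symmetric] by (simp_all add: residue_order_def g_def)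
  have "b dvd a \<longleftrightarrow> g x * b dvd g x * a" using pos by simp
  also have "\<dots> \<longleftrightarrow> g x * b dvd g y * b" using ab by simp
  also have "\<dots> \<longleftrightarrow> g x dvd g y" using pos by simp
  also have "\<dots> \<longleftrightarrow> int (g x) dvd int (g y)" by simp
  finally show ?thesis unfolding o g .
qed

lemma parcs_power_graph_integer_mod_group:
  assumes "n > 0" "x \<in> {0..<int n}" "y \<in> {0..<int n}"
  shows "(x, y) \<in> parcs (power_graph (integer_mod_group n)) \<longleftrightarrow>
    x \<noteq> y \<and> (residue_order n x dvd residue_order n y \<or> residue_order n y dvd residue_order n x)"
proof -
  have "(x, y) \<in> parcs (power_graph (integer_mod_group n)) \<longleftrightarrow> x \<noteq> y \<and>
    ((\<exists>k::nat. k > 0 \<and> y = (int k * x) mod int n) \<or> (\<exists>k::nat. k > 0 \<and> x = (int k * y) mod int n))"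
    using assms by (auto simp: power_graph_def carrier_integer_mod_group)
  then show ?thesis
    using assms by (simp add: multiple_mod_iff_gcd_dvd residue_order_dvd_iff) blast
qed

text \<open>Order \<open>e\<close> means gcd \<open>n div e\<close>, and
  \<open>card_gcd_eq_totient\<close> counts these numbers in \<open>{0<..n}\<close>; reduction
  modulo \<open>n\<close> carries that range to the residues.\<close>

lemma card_residue_order_eq:
  assumes "n > 0" "e dvd n"
  shows "card {x \<in> {0..<int n}. residue_order n x = e} = totient e"
proof -
  have "bij_betw (\<lambda>k. int (k mod n)) {k \<in> {0<..n}. gcd k n = n div e}
      {x \<in> {0..<int n}. residue_order n x = e}"
  proof (rule bij_betw_imageI)
    show "inj_on (\<lambda>k. int (k mod n)) {k \<in> {0<..n}. gcd k n = n div e}"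
      by (rule inj_onI) (auto simp: mod_if split: if_splits)
    have ord: "residue_order n (int k) = e \<longleftrightarrow> gcd k n = n div e" for k
    proof -
      obtain a where a: "n = gcd k n * a" by (metis dvd_def gcd_dvd2)
      obtain b where b: "n = e * b" using assms by (metis dvd_def)
      have "n div gcd k n = a" "n div e = b"
        using assms a b by (metis gcd_pos_nat nonzero_mult_div_cancel_left not_gr0 mult_zero_left)+
      moreover have "a = e \<longleftrightarrow> gcd k n = b"
        using a b assms by (metis mult.commute mult_cancel_left mult_is_0 not_gr0)
      ultimately show ?thesis by (simp add: residue_order_def)
    qed
    show "(\<lambda>k. int (k mod n)) ` {k \<in> {0<..n}. gcd k n = n div e} =
        {x \<in> {0..<int n}. residue_order n x = e}"
    proof (intro equalityI subsetI)
      fix x assume "x \<in> (\<lambda>k. int (k mod n)) ` {k \<in> {0<..n}. gcd k n = n div e}"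
      then obtain k where k: "x = int (k mod n)" "gcd k n = n div e" by auto
      moreover have "gcd (k mod n) n = gcd k n" by (metis gcd.commute gcd_red_nat)
      ultimately show "x \<in> {x \<in> {0..<int n}. residue_order n x = e}"
        using assms by (simp add: ord)
    next
      fix x assume x: "x \<in> {x \<in> {0..<int n}. residue_order n x = e}"
      \<comment> \<open>The residue 0 must come from \<open>n\<close>, since 0 itself lies outside
        \<open>{0<..n}\<close>.\<close>
      define k where "k = (if x = 0 then n else nat x)"
      have "gcd k n = gcd (nat x) n" by (simp add: k_def)
      also have "\<dots> = n div e" using x by (intro ord[THEN iffD1]) auto
      finally have "gcd k n = n div e" .
      moreover have "x = int (k mod n)" "k \<in> {0<..n}" using x assms by (auto simp: k_def)
      ultimately show "x \<in> (\<lambda>k. int (k mod n)) ` {k \<in> {0<..n}. gcd k n = n div e}" by blast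
    qed
  qed
  then have "card {x \<in> {0..<int n}. residue_order n x = e} =
      card {k \<in> {0<..n}. gcd k n = n div e}"
    by (simp add: bij_betw_same_card)
  also have "\<dots> = totient (n div (n div e))"
    using assms by (intro card_gcd_eq_totient) (auto elim!: dvdE)
  also have "n div (n div e) = e" using assms by (auto elim!: dvdE)
  finally show ?thesis .
qed

text \<open>The factorization is read over the complex numbers, where the factor
  \<open>[:b k k - a k, 1:]\<close> has the single root \<open>a k - b k k\<close>.\<close>

lemma eigenvalues_mset_blockwise_constant:
  fixes a :: "nat \<Rightarrow> real" and b :: "nat \<Rightarrow> nat \<Rightarrow> real" and c s :: "nat \<Rightarrow> nat"
  assumes "\<And>i. i < N \<Longrightarrow> c i < m"
    and "\<And>k. k < m \<Longrightarrow> card {i. i < N \<and> c i = k} = s k"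
    and "\<And>k. k < m \<Longrightarrow> s k > 0"
  shows "eigenvalues_mset (mat N N (\<lambda>(i, j). if i = j then a (c i) else b (c i) (c j))) =
    (\<Sum>k<m. replicate_mset (s k - 1) (complex_of_real (a k - b k k))) +
    eigenvalues_mset (mat m m (\<lambda>(k, l). if k = l then a k + real (s k - 1) * b k k
      else real (s l) * b k l))"
    (is "eigenvalues_mset ?A = _ + eigenvalues_mset ?Q")
proof -
  let ?a = "\<lambda>k. complex_of_real (a k)" and ?b = "\<lambda>k l. complex_of_real (b k l)"
  have A: "map_mat complex_of_real ?A =
      mat N N (\<lambda>(i, j). if i = j then ?a (c i) else ?b (c i) (c j))"
    by (rule eq_matI) auto
  have Q: "map_mat complex_of_real ?Q =
      mat m m (\<lambda>(k, l). if k = l then ?a k + of_nat (s k - 1) * ?b k k else of_nat (s l) * ?b k l)"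
    by (rule eq_matI) auto
  have char: "char_poly (map_mat complex_of_real ?A) =
      (\<Prod>k<m. [:?b k k - ?a k, 1:] ^ (s k - 1)) * char_poly (map_mat complex_of_real ?Q)"
    unfolding A Q by (rule char_poly_blockwise_constant[OF assms])
  \<comment> \<open>A monic polynomial is nonzero, which \<open>proots_mult\<close> needs.\<close>
  have "map_mat complex_of_real ?Q \<in> carrier_mat m m" by simp
  from degree_monic_char_poly[OF this] have "char_poly (map_mat complex_of_real ?Q) \<noteq> 0"
    by auto
  then show ?thesis
    unfolding eigenvalues_mset_def char
    by (subst proots_mult) (auto simp: proots_prod proots_power repeat_mset_replicate_mset
        simp flip: replicate_mset_Suc intro!: sum.cong)
qed

section \<open>Spectrum of the power graph\<close>

theorem theorem3p5:
  fixes \<alpha> :: real and n r :: nat and d :: "nat \<Rightarrow> nat" and v :: "nat \<Rightarrow> int"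
  assumes "\<alpha> \<in> {0..1}" and "n \<ge> 3"
    and "bij_betw d {1..r} (nontrivial_divisors n)"
    and "bij_betw v {..<n} (pverts (power_graph (integer_mod_group n)))"
  shows "eigenvalues_mset (A_alpha_mat \<alpha> (power_graph (integer_mod_group n)) v) =
      replicate_mset (totient n) (complex_of_real (\<alpha> * real n - 1))
    + (\<Sum>i = 1..r. replicate_mset (totient (d i) - 1)
         (complex_of_real (\<alpha> * (real (totient (d i)) + real (beta n r d i)) - 1)))
    + eigenvalues_mset (quotient_mat \<alpha> n r d)"
proof -
  let ?G = "power_graph (integer_mod_group n)"
  have n: "n > 0" "n \<noteq> 1" using assms(2) by auto
  have verts: "pverts ?G = {0..<int n}"
    using n by (simp add: power_graph_def carrier_integer_mod_group)
  have v: "bij_betw v {..<n} {0..<int n}" using assms(4) by (simp add: verts)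
  have v_in: "v i \<in> {0..<int n}" if "i < n" for i
    using v that by (auto simp: bij_betw_def)
  have v_eq: "v i = v j \<longleftrightarrow> i = j" if "i < n" "j < n" for i j
    using v that by (auto simp: bij_betw_def inj_on_def)
  have d_in: "d k dvd n" "d k \<noteq> 1" "d k \<noteq> n" "d k > 0" if "k \<in> {1..r}" for k
    using bij_betw_apply[OF assms(3) that] by (auto simp: nontrivial_divisors_def)
  define ord where "ord i = residue_order n (v i)" for i
  have ord_dvd: "ord i dvd n" for i by (simp add: ord_def residue_order_dvd)
  \<comment> \<open>The class of an order is its index under \<open>d\<close>; the index 0, outside
    the range \<open>{1..r}\<close>, serves the orders 1 and \<open>n\<close>.\<close>
  define cl where "cl e = (if e = 1 \<or> e = n then 0 else inv_into {1..r} d e)" for e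
  define c where "c i = cl (ord i)" for i
  define s where "s k = (if k = 0 then totient n + 1 else totient (d k))" for k
  \<comment> \<open>Reflexive, because two orders in one class are either equal or both among 1 and
    \<open>n\<close>, hence comparable.\<close>
  define adj where
    "adj k l \<longleftrightarrow> k = 0 \<or> l = 0 \<or> k = l \<or> (d k, d l) \<in> parcs (divisor_graph n)" for k l
  have adj_refl: "adj k k" for k by (simp add: adj_def)

  have cl_other: "cl e \<in> {1..r}" "d (cl e) = e" if "e dvd n" "e \<noteq> 1" "e \<noteq> n" for e
  proof -
    have "e \<in> nontrivial_divisors n"
      using that n dvd_imp_le[of e n] dvd_pos_nat[of n e] by (simp add: nontrivial_divisors_def)
    then have "e \<in> d ` {1..r}" using assms(3) by (simp add: bij_betw_def)
    then show "cl e \<in> {1..r}" "d (cl e) = e"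
      using that by (auto simp: cl_def inv_into_into f_inv_into_f simp del: atLeastAtMost_iff)
  qed
  have cl_le: "cl e \<le> r" if "e dvd n" for e
    using cl_other[OF that] by (cases "e = 1 \<or> e = n") (auto simp: cl_def)
  have cl_0: "cl e = 0 \<longleftrightarrow> e = 1 \<or> e = n" if "e dvd n" for e
    using cl_other[OF that] by (auto simp: cl_def)
  have cl_eq: "cl e = k \<longleftrightarrow> e = d k" if "e dvd n" "k \<in> {1..r}" for e k
  proof
    show "cl e = k \<Longrightarrow> e = d k" using cl_other[of e] cl_0[of e] that by fastforce
    assume "e = d k"
    then have "cl e = inv_into {1..r} d (d k)" using d_in[OF that(2)] by (simp add: cl_def)
    then show "cl e = k"
      using that(2) assms(3) by (simp add: bij_betw_def inv_into_f_f del: atLeastAtMost_iff)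
  qed
  have comparable: "e dvd f \<or> f dvd e \<longleftrightarrow> adj (cl e) (cl f)" if "e dvd n" "f dvd n" for e f
  proof (cases "e = 1 \<or> e = n \<or> f = 1 \<or> f = n")
    case True
    then show ?thesis using that by (auto simp: adj_def cl_0)
  next
    case False
    note e = cl_other[of e] and f = cl_other[of f]
    have "d (cl e) \<in> nontrivial_divisors n" "d (cl f) \<in> nontrivial_divisors n"
      using False that e(1) f(1) bij_betwE[OF assms(3)] by blast+
    \<comment> \<open>Arcs of the divisor graph join distinct divisors only; equal orders are caught
      by the clause \<open>k = l\<close> of \<open>adj\<close>.\<close>
    moreover have "cl e = cl f \<longleftrightarrow> e = f" using False that e f by metis
    ultimately show ?thesis
      using False that e f by (auto simp: adj_def divisor_graph_def cl_0)
  qed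

  have c_le: "c i \<le> r" for i by (simp add: c_def cl_le ord_dvd)
  have arcs: "(v i, v j) \<in> parcs ?G \<longleftrightarrow> i \<noteq> j \<and> adj (c i) (c j)" if "i < n" "j < n" for i j
    using that n v_in comparable[OF ord_dvd ord_dvd]
    by (simp add: parcs_power_graph_integer_mod_group v_eq c_def ord_def)
  have card_ord: "card {i. i < n \<and> ord i = e} = totient e" if "e dvd n" for e
  proof -
    have "bij_betw v {i. i < n \<and> ord i = e} {x \<in> {0..<int n}. residue_order n x = e}"
      using v by (auto simp: bij_betw_def inj_on_def ord_def image_iff)
    then show ?thesis
      using card_residue_order_eq[OF n(1) that] by (simp add: bij_betw_same_card)
  qed
  have card_class: "card {i. i < n \<and> c i = k} = s k" if "k \<le> r" for k
  proof (cases "k = 0")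
    case True
    have "{i. i < n \<and> c i = k} = {i. i < n \<and> ord i = 1} \<union> {i. i < n \<and> ord i = n}"
      using True ord_dvd by (auto simp: c_def cl_0)
    \<comment> \<open>The identity and the generators; the two sets are disjoint as
      \<open>n \<noteq> 1\<close>.\<close>
    also have "card \<dots> = totient 1 + totient n"
      using n by (subst card_Un_disjoint) (auto simp: card_ord simp del: One_nat_def)
    finally show ?thesis using True by (simp add: s_def)
  next
    case False
    then have "{i. i < n \<and> c i = k} = {i. i < n \<and> ord i = d k}"
      using that ord_dvd by (auto simp: c_def cl_eq)
    then show ?thesis using False that d_in[of k] by (simp add: s_def card_ord)
  qed
  have s_pos: "s k > 0" if "k \<le> r" for k
    using d_in[of k] that by (cases "k = 0") (auto simp: s_def)

  \<comment> \<open>Vertex degrees\<close>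
  define nbr where "nbr k = {l. l \<le> r \<and> adj k l}" for k
  have card_nbr: "card {j. j < n \<and> adj k (c j)} = (\<Sum>l\<in>nbr k. s l)" for k
  proof -
    have "card {j. j < n \<and> adj k (c j)} =
        (\<Sum>l\<in>nbr k. \<Sum>j | j \<in> {j. j < n \<and> adj k (c j)} \<and> c j = l. 1)"
      using c_le by (subst sum.group) (auto simp: nbr_def)
    also have "\<dots> = (\<Sum>l\<in>nbr k. s l)"
    proof (rule sum.cong)
      fix l assume "l \<in> nbr k"
      then have "{j. j \<in> {j. j < n \<and> adj k (c j)} \<and> c j = l} = {i. i < n \<and> c i = l}" "l \<le> r"
        by (auto simp: nbr_def)
      then show "(\<Sum>j | j \<in> {j. j < n \<and> adj k (c j)} \<and> c j = l. 1) = s l"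
        using card_class by simp
    qed simp
    finally show ?thesis .
  qed
  \<comment> \<open>Size of a closed neighbourhood: the vertex itself is counted, so its degree is
    one less.\<close>
  define deg where "deg k = (if k = 0 then n else totient (d k) + beta n r d k)" for k
  have nbr_sum: "(\<Sum>l\<in>nbr k. s l) = deg k" if "k \<le> r" for k
  proof (cases "k = 0")
    case True
    \<comment> \<open>Class 0 is adjacent to every class, so counting vertices gives
      \<open>n\<close> directly, without summing totients.\<close>
    then show ?thesis by (simp add: deg_def adj_def flip: card_nbr)
  next
    case False
    let ?B = "{j. j \<in> {1..r} \<and> (d j, d k) \<in> parcs (divisor_graph n)}"
    \<comment> \<open>Class 0 supplies the term \<open>totient n + 1\<close> of \<open>beta\<close>.
      Arcs leave \<open>d k\<close> in \<open>adj\<close> but enter it in \<open>beta\<close>;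
      symmetry identifies the two.\<close>
    have "nbr k = insert 0 (insert k ?B)"
      using that False by (auto simp: nbr_def adj_def divisor_graph_def)
    moreover have "k \<notin> ?B" by (auto simp: divisor_graph_def)
    moreover have "(\<Sum>l\<in>?B. s l) = (\<Sum>l\<in>?B. totient (d l))"
      by (intro sum.cong) (auto simp: s_def)
    ultimately show ?thesis
      using False by (simp add: deg_def beta_def s_def)
  qed
  have degree: "out_degree (with_proj ?G) (v i) = deg (c i) - 1" if "i < n" for i
  proof -
    have out: "out_arcs (with_proj ?G) (v i) =
        (\<lambda>j. (v i, v j)) ` {j. j < n \<and> j \<noteq> i \<and> adj (c i) (c j)}"
    proof (intro equalityI subsetI)
      fix p assume "p \<in> out_arcs (with_proj ?G) (v i)"
      then obtain y where p: "p = (v i, y)" "(v i, y) \<in> parcs ?G"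
        by (cases p) (auto simp: out_arcs_def)
      then have "y \<in> pverts ?G" by (auto simp: power_graph_def)
      then obtain j where "y = v j" "j < n" using assms(4) by (auto simp: bij_betw_def)
      then show "p \<in> (\<lambda>j. (v i, v j)) ` {j. j < n \<and> j \<noteq> i \<and> adj (c i) (c j)}"
        using p arcs[OF that, of j] by auto
    next
      fix p assume "p \<in> (\<lambda>j. (v i, v j)) ` {j. j < n \<and> j \<noteq> i \<and> adj (c i) (c j)}"
      then show "p \<in> out_arcs (with_proj ?G) (v i)"
        using arcs[OF that] by (auto simp: out_arcs_def)
    qed
    have "out_degree (with_proj ?G) (v i) = card {j. j < n \<and> j \<noteq> i \<and> adj (c i) (c j)}"
      unfolding out_degree_def out by (rule card_image) (auto simp: inj_on_def v_eq)
    also have "{j. j < n \<and> j \<noteq> i \<and> adj (c i) (c j)} = {j. j < n \<and> adj (c i) (c j)} - {i}"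
      by auto
    also have "card \<dots> = deg (c i) - 1"
      using that adj_refl by (subst card_Diff_singleton) (auto simp: card_nbr nbr_sum c_le)
    finally show ?thesis .
  qed
  \<comment> \<open>Lets the natural number \<open>deg k - 1\<close> become
    \<open>real (deg k) - 1\<close> in the matrix entries.\<close>
  have deg_pos: "deg k \<ge> 1" for k using n by (auto simp: deg_def beta_def)

  \<comment> \<open>Matrix entries and the resulting eigenvalues\<close>
  define a where "a k = \<alpha> * (real (deg k) - 1)" for k
  define b where "b k l = (if adj k l then 1 - \<alpha> else 0)" for k l
  have A: "A_alpha_mat \<alpha> ?G v = mat n n (\<lambda>(i, j). if i = j then a (c i) else b (c i) (c j))"
    using deg_pos
    by (intro eq_matI) (auto simp: A_alpha_mat_def degree_mat_def adjacency_mat_def verts arcs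
        degree a_def b_def of_nat_diff)
  have eigenvalues: "eigenvalues_mset (A_alpha_mat \<alpha> ?G v) =
    (\<Sum>k<r + 1. replicate_mset (s k - 1) (complex_of_real (a k - b k k))) +
    eigenvalues_mset (mat (r + 1) (r + 1) (\<lambda>(k, l). if k = l then a k + real (s k - 1) * b k k
      else real (s l) * b k l))"
    unfolding A using c_le card_class s_pos
    by (intro eigenvalues_mset_blockwise_constant) (auto simp: less_Suc_eq_le)
  have quotient: "mat (r + 1) (r + 1) (\<lambda>(k, l). if k = l then a k + real (s k - 1) * b k k
      else real (s l) * b k l) = quotient_mat \<alpha> n r d"
  proof (rule eq_matI)
    fix k l assume "k < dim_row (quotient_mat \<alpha> n r d)" "l < dim_col (quotient_mat \<alpha> n r d)"
    then have kl: "k \<le> r" "l \<le> r" by (auto simp: quotient_mat_def)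
    have diag: "real (s k - 1) = real (s k) - 1" using s_pos[OF kl(1)] by (simp add: of_nat_diff)
    have "(if k = l then a k + real (s k - 1) * b k k else real (s l) * b k l) =
        quotient_mat \<alpha> n r d $$ (k, l)"
    proof (cases "k = l")
      case True
      then show ?thesis
        unfolding diag using kl
        by (cases "k = 0")
          (simp_all add: quotient_mat_def a_def b_def adj_def s_def deg_def algebra_simps)
    next
      case False
      \<comment> \<open>Entries are weighted by the size of the column class, which is why column 0
        carries \<open>totient n + 1\<close> and row 0 the \<open>totient (d l)\<close>.\<close>
      then show ?thesis
        using kl by (simp add: quotient_mat_def b_def adj_def s_def)
    qed
    then show "mat (r + 1) (r + 1) (\<lambda>(k, l). if k = l then a k + real (s k - 1) * b k k
        else real (s l) * b k l) $$ (k, l) = quotient_mat \<alpha> n r d $$ (k, l)"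
      using kl by simp
  qed (simp_all add: quotient_mat_def)
  have "(\<Sum>k<r + 1. replicate_mset (s k - 1) (complex_of_real (a k - b k k))) =
      replicate_mset (totient n) (complex_of_real (\<alpha> * real n - 1))
    + (\<Sum>i = 1..r. replicate_mset (totient (d i) - 1)
         (complex_of_real (\<alpha> * (real (totient (d i)) + real (beta n r d i)) - 1)))"
  proof -
    \<comment> \<open>Here \<open>b k k\<close> is \<open>1 - \<alpha>\<close> by reflexivity of
      \<open>adj\<close>, so the two bare terms in \<alpha> cancel.\<close>
    have eig: "a k - b k k = \<alpha> * real (deg k) - 1" for k
      by (simp add: a_def b_def adj_def algebra_simps)
    \<comment> \<open>The summand of class 0 is split off; its multiplicity \<open>s 0 - 1\<close>
      is \<open>totient n\<close>.\<close>
    show ?thesis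
      unfolding eig
      by (simp add: sum.lessThan_Suc_shift sum.atLeast1_atMost_eq s_def deg_def
          del: sum.lessThan_Suc of_real_diff of_real_mult)
  qed
  then show ?thesis unfolding eigenvalues quotient by (rule arg_cong)
qed

end
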